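(* The language $L_\infty$ is quasigeodesic (as a normal form for Thompson's group $F$ with respect to $X=\{x_0^{\pm1},x_1^{\pm1}\}$). That is, there is a constant $D$ such that $|u|\le D(\|u\|_X+1)$ for every $u\in L_\infty$, where $|u|$ is the number of letters of $u$ and $\|u\|_X$ is the length of a geodesic word in $X^*$ for the element $\overline u\in F$ represented by $u$.
   Context: Thompson's group $F$ is the group with presentation $\langle x_0,x_1,x_2,\dots \mid x_jx_i=x_ix_{j+1}\text{ whenever } i<j\rangle$; it is generated by $x_0,x_1$. The language $L_\infty\subseteq\{a,b,\#\}^*$ consists of the empty string together with all strings of the form $a^{r_0}b^{s_0}\#a^{r_1}b^{s_1}\#\cdots\#a^{r_M}b^{s_M}$ with $M\ge 0$, where all $r_i,s_i\ge0$ are integers, exactly one of $r_M,s_M$ is nonzero, and for all $0\le i<M$, $r_is_i>0$ implies $r_{i+1}+s_{i+1}>0$. The string $u=a^{r_0}b^{s_0}\#\cdots\#a^{r_M}b^{s_M}$ represents the element $\overline u=x_0^{r_0}x_1^{r_1}\cdots x_M^{r_M}x_M^{-s_M}\cdots x_1^{-s_1}x_0^{-s_0}$ of $F$, and the empty string represents the identity. *)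

theory Defs
  imports Complex_Main "HOL-Algebra.Generated_Groups"
begin

section \<open>Groups given by generators and relations\<close>

text \<open>A word over the generators and their inverses: the letter \<open>(g, True)\<close> stands for
  the generator \<open>g\<close>, the letter \<open>(g, False)\<close> for its formal inverse. A relation
  \<open>u = v\<close> is a pair of words.\<close>

type_synonym 'g gword = "('g \<times> bool) list"

inductive pres_eq :: "('g gword \<times> 'g gword) set \<Rightarrow> 'g gword \<Rightarrow> 'g gword \<Rightarrow> bool"
  for R :: "('g gword \<times> 'g gword) set"
where
  pres_rel: "(u, v) \<in> R \<Longrightarrow> pres_eq R u v"
| pres_cancel: "pres_eq R [(g, b), (g, \<not> b)] []"
| pres_refl: "pres_eq R u u"
| pres_sym: "pres_eq R u v \<Longrightarrow> pres_eq R v u"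
| pres_trans: "pres_eq R u v \<Longrightarrow> pres_eq R v w \<Longrightarrow> pres_eq R u w"
| pres_context: "pres_eq R u v \<Longrightarrow> pres_eq R (p @ u @ q) (p @ v @ q)"

definition pres_class :: "('g gword \<times> 'g gword) set \<Rightarrow> 'g gword \<Rightarrow> 'g gword set" where
  "pres_class R w = {v. pres_eq R w v}"

definition presented_group :: "('g gword \<times> 'g gword) set \<Rightarrow> 'g gword set monoid" where
  "presented_group R =
     \<lparr>carrier = range (pres_class R),
      mult = (\<lambda>U V. {w. \<exists>u\<in>U. \<exists>v\<in>V. pres_eq R (u @ v) w}),
      one = pres_class R []\<rparr>"

lemma pres_eq_append:
  assumes "pres_eq R u u'" "pres_eq R v v'"
  shows "pres_eq R (u @ v) (u' @ v')"
  using pres_context[OF assms(1), of "[]" v] pres_context[OF assms(2), of u' "[]"]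
  by (auto intro: pres_trans)

lemma pres_class_eq_iff: "pres_class R u = pres_class R v \<longleftrightarrow> pres_eq R u v"
  unfolding pres_class_def set_eq_iff mem_Collect_eq
  by (meson pres_refl pres_sym pres_trans)

lemma presented_mult:
  "pres_class R u \<otimes>\<^bsub>presented_group R\<^esub> pres_class R v = pres_class R (u @ v)"
  unfolding presented_group_def pres_class_def
  by (auto intro: pres_trans pres_eq_append pres_refl)

lemma presented_one: "\<one>\<^bsub>presented_group R\<^esub> = pres_class R []"
  by (simp add: presented_group_def)

lemma presented_carrier: "carrier (presented_group R) = range (pres_class R)"
  by (simp add: presented_group_def)

definition inv_word :: "'g gword \<Rightarrow> 'g gword" where
  "inv_word w = rev (map (\<lambda>(g, b). (g, \<not> b)) w)"

lemma pres_eq_inv_word: "pres_eq R (inv_word w @ w) []"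
proof (induction w)
  case Nil
  then show ?case by (simp add: inv_word_def pres_refl)
next
  case (Cons l w)
  obtain g b where l: "l = (g, b)" by force
  have "pres_eq R (inv_word w @ [(g, \<not> b), (g, \<not> \<not> b)] @ w) (inv_word w @ [] @ w)"
    by (intro pres_context pres_cancel)
  then show ?case
    using Cons by (auto simp: inv_word_def l intro: pres_trans)
qed

lemma group_presented_group: "group (presented_group R)"
proof (rule groupI)
  fix x assume "x \<in> carrier (presented_group R)"
  then obtain w where "x = pres_class R w" by (auto simp: presented_carrier)
  then have "pres_class R (inv_word w) \<otimes>\<^bsub>presented_group R\<^esub> x = \<one>\<^bsub>presented_group R\<^esub>"
    by (simp add: presented_mult presented_one pres_class_eq_iff pres_eq_inv_word)
  then show "\<exists>y\<in>carrier (presented_group R). y \<otimes>\<^bsub>presented_group R\<^esub> x = \<one>\<^bsub>presented_group R\<^esub>"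
    by (auto simp: presented_carrier)
qed (auto simp: presented_carrier presented_mult presented_one)

section \<open>Word length and quasigeodesic languages\<close>

definition word_value :: "('g, 'm) monoid_scheme \<Rightarrow> 'g list \<Rightarrow> 'g" where
  "word_value G w = foldr (mult G) w \<one>\<^bsub>G\<^esub>"

definition geod_length :: "('g, 'm) monoid_scheme \<Rightarrow> 'g set \<Rightarrow> 'g \<Rightarrow> nat" where
  "geod_length G X g = (LEAST n. \<exists>w\<in>lists X. word_value G w = g \<and> length w = n)"

definition quasigeodesic ::
  "('g, 'm) monoid_scheme \<Rightarrow> 'g set \<Rightarrow> ('c list \<Rightarrow> 'g) \<Rightarrow> 'c list set \<Rightarrow> bool" where
  "quasigeodesic G X rep L \<longleftrightarrow>
     (\<exists>D::real. \<forall>u\<in>L. real (length u) \<le> D * (real (geod_length G X (rep u)) + 1))"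

section \<open>Thompson's group F\<close>

definition thompson_rels :: "(nat gword \<times> nat gword) set" where
  "thompson_rels =
     {([(j, True), (i, True)], [(i, True), (Suc j, True)]) | i j. i < j}"

definition ThompsonF :: "nat gword set monoid" where
  "ThompsonF = presented_group thompson_rels"

definition xgen :: "nat \<Rightarrow> nat gword set" where
  "xgen i = pres_class thompson_rels [(i, True)]"

definition Xgens :: "nat gword set set" where
  "Xgens = {xgen 0, inv\<^bsub>ThompsonF\<^esub> xgen 0, xgen 1, inv\<^bsub>ThompsonF\<^esub> xgen 1}"

lemma group_ThompsonF: "group ThompsonF"
  by (simp add: ThompsonF_def group_presented_group)

interpretation F: group ThompsonF
  by (rule group_ThompsonF)

lemma xgen_closed [simp]: "xgen i \<in> carrier ThompsonF"
  by (simp add: ThompsonF_def xgen_def presented_carrier)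

lemma xgen_rel: "i < j \<Longrightarrow> xgen j \<otimes>\<^bsub>ThompsonF\<^esub> xgen i = xgen i \<otimes>\<^bsub>ThompsonF\<^esub> xgen (Suc j)"
  by (auto simp: ThompsonF_def xgen_def presented_mult pres_class_eq_iff thompson_rels_def intro: pres_rel)

lemma word_value_append:
  assumes "v \<in> lists (carrier ThompsonF)" "w \<in> lists (carrier ThompsonF)"
  shows "word_value ThompsonF v \<in> carrier ThompsonF"
    and "word_value ThompsonF (v @ w) = word_value ThompsonF v \<otimes>\<^bsub>ThompsonF\<^esub> word_value ThompsonF w"
proof -
  have c: "word_value ThompsonF v \<in> carrier ThompsonF" if "v \<in> lists (carrier ThompsonF)" for v
    using that by (induction v) (auto simp: word_value_def)
  then show "word_value ThompsonF v \<in> carrier ThompsonF" using assms by blast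
  show "word_value ThompsonF (v @ w) = word_value ThompsonF v \<otimes>\<^bsub>ThompsonF\<^esub> word_value ThompsonF w"
    using assms
  proof (induction v)
    case Nil
    then show ?case using c[of w] by (simp add: word_value_def)
  next
    case (Cons a v)
    then show ?case
      using c[of v] c[of w] by (simp add: word_value_def F.m_assoc)
  qed
qed

lemma Xgens_carrier: "Xgens \<subseteq> carrier ThompsonF"
  by (auto simp: Xgens_def)

lemma word_value_single:
  "g \<in> Xgens \<Longrightarrow> \<exists>w\<in>lists Xgens. word_value ThompsonF w = g"
  using Xgens_carrier by (intro bexI[of _ "[g]"]) (auto simp: word_value_def)

lemma letter_has_Xgens_word:
  "\<exists>w\<in>lists Xgens. word_value ThompsonF w = xgen i" "\<exists>w\<in>lists Xgens. word_value ThompsonF w = inv\<^bsub>ThompsonF\<^esub> xgen i"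
proof -
  have "(\<exists>w\<in>lists Xgens. word_value ThompsonF w = xgen i) \<and> (\<exists>w\<in>lists Xgens. word_value ThompsonF w = inv\<^bsub>ThompsonF\<^esub> xgen i)"
  proof (induction i rule: less_induct)
    case (less i)
    consider "i = 0" | "i = 1" | j where "i = Suc j" "0 < j"
      by (metis One_nat_def gr0I not0_implies_Suc)
    then show ?case
    proof cases
      case 1
      then show ?thesis
        using word_value_single[of "xgen 0"] word_value_single[of "inv\<^bsub>ThompsonF\<^esub> xgen 0"]
        unfolding 1 by (simp add: Xgens_def)
    next
      case 2
      then show ?thesis
        using word_value_single[of "xgen 1"] word_value_single[of "inv\<^bsub>ThompsonF\<^esub> xgen 1"]
        unfolding 2 by (simp add: Xgens_def)
    next
      case 3
      then obtain v w where v: "v \<in> lists Xgens" "word_value ThompsonF v = xgen j"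
        and w: "w \<in> lists Xgens" "word_value ThompsonF w = inv\<^bsub>ThompsonF\<^esub> xgen j"
        using less[of j] by auto
      have conj: "xgen i = inv\<^bsub>ThompsonF\<^esub> xgen 0 \<otimes>\<^bsub>ThompsonF\<^esub> xgen j \<otimes>\<^bsub>ThompsonF\<^esub> xgen 0"
        using xgen_rel[OF 3(2)] 3(1)
        by (simp add: F.m_assoc F.inv_solve_left)
      have conj': "inv\<^bsub>ThompsonF\<^esub> xgen i = inv\<^bsub>ThompsonF\<^esub> xgen 0 \<otimes>\<^bsub>ThompsonF\<^esub> inv\<^bsub>ThompsonF\<^esub> xgen j \<otimes>\<^bsub>ThompsonF\<^esub> xgen 0"
        unfolding conj by (simp add: F.inv_mult_group F.m_assoc)
      have wrap: "word_value ThompsonF ([inv\<^bsub>ThompsonF\<^esub> xgen 0] @ u @ [xgen 0]) =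
          inv\<^bsub>ThompsonF\<^esub> xgen 0 \<otimes>\<^bsub>ThompsonF\<^esub> word_value ThompsonF u \<otimes>\<^bsub>ThompsonF\<^esub> xgen 0" if "u \<in> lists Xgens" for u
      proof -
        have u: "u \<in> lists (carrier ThompsonF)" using that Xgens_carrier by auto
        show ?thesis
          using word_value_append[OF u, of "[xgen 0]"]
          by (simp add: word_value_def F.m_assoc)
      qed
      have "[inv\<^bsub>ThompsonF\<^esub> xgen 0] @ u @ [xgen 0] \<in> lists Xgens" if "u \<in> lists Xgens" for u
        using that by (auto simp: Xgens_def)
      from this[OF v(1)] this[OF w(1)] show ?thesis
        using wrap[OF v(1)] wrap[OF w(1)] unfolding v(2) w(2) conj[symmetric] conj'[symmetric]
        by blast
    qed
  qed
  then show "\<exists>w\<in>lists Xgens. word_value ThompsonF w = xgen i" "\<exists>w\<in>lists Xgens. word_value ThompsonF w = inv\<^bsub>ThompsonF\<^esub> xgen i"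
    by auto
qed

text \<open>Since \<open>xgen 0\<close> and \<open>xgen 1\<close> generate \<open>ThompsonF\<close>, the minimum in \<^const>\<open>geod_length\<close> is attained.\<close>

lemma ex_Xgens_word:
  assumes "g \<in> carrier ThompsonF"
  shows "\<exists>w\<in>lists Xgens. word_value ThompsonF w = g"
proof -
  have "\<exists>w\<in>lists Xgens. word_value ThompsonF w = pres_class thompson_rels u" for u
  proof (induction u)
    case Nil
    show ?case
      by (intro bexI[of _ "[]"]) (auto simp: word_value_def ThompsonF_def presented_one)
  next
    case (Cons l u)
    obtain i b where l: "l = (i, b)" by force
    have inv: "pres_class thompson_rels [(i, False)] = inv\<^bsub>ThompsonF\<^esub> xgen i"
    proof (rule F.inv_equality[symmetric])
      have "pres_eq thompson_rels [(i, False), (i, \<not> False)] []" by (rule pres_cancel)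
      then show "pres_class thompson_rels [(i, False)] \<otimes>\<^bsub>ThompsonF\<^esub> xgen i = \<one>\<^bsub>ThompsonF\<^esub>"
        by (simp add: ThompsonF_def xgen_def presented_mult presented_one pres_class_eq_iff)
    qed (auto simp: ThompsonF_def presented_carrier xgen_def)
    have "\<exists>v\<in>lists Xgens. word_value ThompsonF v = pres_class thompson_rels [l]"
      using letter_has_Xgens_word[of i] inv by (cases b) (auto simp: l xgen_def)
    then obtain v w where "v \<in> lists Xgens" "word_value ThompsonF v = pres_class thompson_rels [l]"
      "w \<in> lists Xgens" "word_value ThompsonF w = pres_class thompson_rels u"
      using Cons by auto
    moreover from this have "word_value ThompsonF (v @ w) = pres_class thompson_rels (l # u)"
      using Xgens_carrier presented_mult[of thompson_rels "[l]" u]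
      by (subst word_value_append(2)) (auto simp: ThompsonF_def)
    ultimately show ?case by (intro bexI[of _ "v @ w"]) auto
  qed
  then show ?thesis using assms by (auto simp: ThompsonF_def presented_carrier)
qed

lemma geod_length_attained:
  assumes "g \<in> carrier ThompsonF"
  shows "\<exists>w\<in>lists Xgens. word_value ThompsonF w = g \<and> length w = geod_length ThompsonF Xgens g"
  unfolding geod_length_def
  by (rule LeastI_ex) (use ex_Xgens_word[OF assms] in auto)

section \<open>The language\<close>

datatype letter = La | Lb | Hash

definition block :: "nat \<Rightarrow> nat \<Rightarrow> letter list" where
  "block m n = replicate m La @ replicate n Lb"

primrec nf_string :: "(nat \<Rightarrow> nat) \<Rightarrow> (nat \<Rightarrow> nat) \<Rightarrow> nat \<Rightarrow> letter list" where
  "nf_string r s 0 = block (r 0) (s 0)"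
| "nf_string r s (Suc M) = nf_string r s M @ Hash # block (r (Suc M)) (s (Suc M))"

definition L_inf :: "letter list set" where
  "L_inf = {[]} \<union> {nf_string r s M | r s M.
     (r M \<noteq> 0) \<noteq> (s M \<noteq> 0) \<and>
     (\<forall>i<M. r i * s i > 0 \<longrightarrow> r (Suc i) + s (Suc i) > 0)}"

primrec pos_part :: "(nat \<Rightarrow> nat) \<Rightarrow> nat \<Rightarrow> nat gword set" where
  "pos_part r 0 = xgen 0 [^]\<^bsub>ThompsonF\<^esub> int (r 0)"
| "pos_part r (Suc M) = pos_part r M \<otimes>\<^bsub>ThompsonF\<^esub> xgen (Suc M) [^]\<^bsub>ThompsonF\<^esub> int (r (Suc M))"

primrec neg_part :: "(nat \<Rightarrow> nat) \<Rightarrow> nat \<Rightarrow> nat gword set" where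
  "neg_part s 0 = xgen 0 [^]\<^bsub>ThompsonF\<^esub> (- int (s 0))"
| "neg_part s (Suc M) = xgen (Suc M) [^]\<^bsub>ThompsonF\<^esub> (- int (s (Suc M))) \<otimes>\<^bsub>ThompsonF\<^esub> neg_part s M"

definition nf_element :: "(nat \<Rightarrow> nat) \<Rightarrow> (nat \<Rightarrow> nat) \<Rightarrow> nat \<Rightarrow> nat gword set" where
  "nf_element r s M = pos_part r M \<otimes>\<^bsub>ThompsonF\<^esub> neg_part s M"

text \<open>A string determines \<open>M\<close> and the exponents up to \<open>M\<close>, so the description is unique on all
  strings of the form \<^const>\<open>nf_string\<close>; see \<open>nf_rep_nf_string\<close> below. The empty string is
  \<^term>\<open>nf_string (\<lambda>_. 0) (\<lambda>_. 0) 0\<close> and represents the identity.\<close>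

definition nf_rep :: "letter list \<Rightarrow> nat gword set" where
  "nf_rep u = (THE g. \<exists>r s M. u = nf_string r s M \<and> g = nf_element r s M)"

lemma block_inject: "block m n = block m' n' \<longleftrightarrow> m = m' \<and> n = n'"
proof
  assume *: "block m n = block m' n'"
  have "count_list (block m n) La = m" "count_list (block m n) Lb = n" for m n
    by (induction m; induction n; auto simp: block_def)+
  with * show "m = m' \<and> n = n'" by metis
qed auto

lemma Hash_notin_block: "Hash \<notin> set (block m n)"
  by (auto simp: block_def)

lemma append_Hash_inject:
  assumes "Hash \<notin> set v" "Hash \<notin> set v'"
  shows "u @ Hash # v = u' @ Hash # v' \<longleftrightarrow> u = u' \<and> v = v'"
proof
  assume *: "u @ Hash # v = u' @ Hash # v'"
  have v: "takeWhile (\<lambda>l. l \<noteq> Hash) (rev (u @ Hash # v)) = rev v"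
    if "Hash \<notin> set v" for u v
    using that by (auto simp: takeWhile_append takeWhile_eq_all_conv)
  have "v = v'"
    using v[OF assms(1), of u] v[OF assms(2), of u'] * by simp
  with * show "u = u' \<and> v = v'" by simp
qed simp

lemma nf_string_inject:
  assumes "nf_string r s M = nf_string r' s' M'"
  shows "M = M' \<and> (\<forall>i\<le>M. r i = r' i \<and> s i = s' i)"
  using assms
proof (induction M arbitrary: M')
  case 0
  then show ?case
    using Hash_notin_block[of "r 0" "s 0"] by (cases M') (auto simp: block_inject)
next
  case (Suc M)
  show ?case
  proof (cases M')
    case 0
    have "Hash \<in> set (nf_string r s (Suc M))" by simp
    then have "Hash \<in> set (nf_string r' s' 0)" by (simp only: Suc.prems 0)
    then show ?thesis by (simp add: Hash_notin_block)
  next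
    case (Suc N)
    have eq: "nf_string r s M = nf_string r' s' N"
      "r (Suc M) = r' (Suc N)" "s (Suc M) = s' (Suc N)"
      using Suc.prems unfolding Suc nf_string.simps
      by (simp_all only: append_Hash_inject[OF Hash_notin_block Hash_notin_block] block_inject)
    have "M = N" and le: "\<forall>i\<le>M. r i = r' i \<and> s i = s' i"
      using Suc.IH[OF eq(1)] by blast+
    then show ?thesis
      using eq(2,3) by (simp only: Suc le_Suc_eq) blast
  qed
qed

lemma nf_rep_nf_string: "nf_rep (nf_string r s M) = nf_element r s M"
proof -
  have "nf_element r s M = nf_element r' s' M"
    if "\<forall>i\<le>M. r i = r' i \<and> s i = s' i" for r' s'
  proof -
    have "pos_part r N = pos_part r' N \<and> neg_part s N = neg_part s' N" if "N \<le> M" for N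
      using that \<open>\<forall>i\<le>M. r i = r' i \<and> s i = s' i\<close> by (induction N) auto
    then show ?thesis by (simp add: nf_element_def)
  qed
  then show ?thesis
    unfolding nf_rep_def by (intro the_equality) (auto dest!: nf_string_inject)
qed

lemma nf_rep_Nil: "nf_rep [] = \<one>\<^bsub>ThompsonF\<^esub>"
  using nf_rep_nf_string[of "\<lambda>_. 0" "\<lambda>_. 0" 0] by (simp add: block_def nf_element_def)

end

theory Submission
  imports Defs "HOL-Library.Stream"
begin

text \<open>
  The number of letters of a string in \<^const>\<open>L_inf\<close> is, up to one, the \<^emph>\<open>weight\<close> of its list of
  exponent pairs \<open>(r\<^sub>0, s\<^sub>0), \<dots>, (r\<^sub>M, s\<^sub>M)\<close>: the sum of all exponents plus the number of pairs. Any
  such list, subject to the conditions of \<^const>\<open>L_inf\<close> or not, describes an element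
  \<open>x\<^sub>0\<^bsup>r\<^sub>0\<^esup> \<cdots> x\<^sub>M\<^bsup>r\<^sub>M\<^esup> x\<^sub>M\<^bsup>-s\<^sub>M\<^esup> \<cdots> x\<^sub>0\<^bsup>-s\<^sub>0\<^esup>\<close>. Three facts give the theorem.

  \<^item> A product of \<open>n\<close> letters \<open>x\<^sub>0\<^sup>\<plusminus>, x\<^sub>1\<^sup>\<plusminus>\<close> is described by some list with exponent sum at most \<open>n\<close>
    and length at most \<open>n + 1\<close> (\<open>word_value_eval\<close>): the defining relations let each new letter
    travel to its place, keeping the number of letters, while its index grows by at most one for
    each letter it passes (\<open>eval_insert\<close>).
  \<^item> A list violating the conditions of \<^const>\<open>L_inf\<close> can be replaced by a strictly lighter one for
    the same element, by cancelling or by using \<open>x\<^sub>i x\<^sub>j\<^sub>+\<^sub>1 x\<^sub>i\<^sup>-\<^sup>1 = x\<^sub>j\<close> (\<open>eval_lighter\<close>).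
  \<^item> Lists satisfying the conditions are determined by the element (\<open>reduced_unique\<close>).

  Hence the list of a string \<open>u\<close> in \<^const>\<open>L_inf\<close> has the least weight among the lists of its
  element, and so \<open>|u| \<le> 2n\<close> when the element is a product of \<open>n\<close> letters.

  Uniqueness needs a concrete model in which elements can be told apart. The model is the action
  of \<open>F\<close> on an infinite row of Cantor sets, thought of as infinite binary trees numbered
  \<open>0, 1, 2, \<dots>\<close>: \<open>x\<^sub>i\<close> joins the trees \<open>i\<close> and \<open>i + 1\<close> under a new root and renumbers the later
  trees. In this model the shift \<open>x\<^sub>i \<mapsto> x\<^sub>i\<^sub>+\<^sub>1\<close> is simply ignoring tree \<open>0\<close>, which makes the normal
  form recursive in the list. The three facts are proved for the transformations of the model;
  a string and a word for the same element induce the same transformation.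
\<close>

section \<open>Forest transformations\<close>

text \<open>The point \<open>(n, bs)\<close> is the end of tree \<open>n\<close> that is reached from the root by the turns \<open>bs\<close>.\<close>

type_synonym point = "nat \<times> bool stream"

fun merge :: "point \<Rightarrow> point" where
  "merge (0, bs) = (0, False ## bs)"
| "merge (Suc 0, bs) = (0, True ## bs)"
| "merge (Suc (Suc n), bs) = (Suc n, bs)"

fun unmerge :: "point \<Rightarrow> point" where
  "unmerge (0, bs) = (if shd bs then Suc 0 else 0, stl bs)"
| "unmerge (Suc n, bs) = (Suc (Suc n), bs)"

fun shifted :: "(point \<Rightarrow> point) \<Rightarrow> point \<Rightarrow> point" where
  "shifted f (0, bs) = (0, bs)"
| "shifted f (Suc n, bs) = apfst Suc (f (n, bs))"

lemma unmerge_merge: "unmerge \<circ> merge = id"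
proof
  fix p show "(unmerge \<circ> merge) p = id p"
    by (cases p rule: merge.cases) auto
qed

lemma merge_unmerge: "merge \<circ> unmerge = id"
proof
  fix p show "(merge \<circ> unmerge) p = id p"
    by (cases p rule: unmerge.cases) (auto simp: stream.expand)
qed

lemma shifted_id [simp]: "shifted id = id"
proof
  fix p show "shifted id p = id p"
    by (cases p rule: unmerge.cases) auto
qed

lemma shifted_comp: "shifted (f \<circ> g) = shifted f \<circ> shifted g"
proof
  fix p :: point show "shifted (f \<circ> g) p = (shifted f \<circ> shifted g) p"
  proof (cases p rule: unmerge.cases)
    case (2 n bs)
    then show ?thesis by (cases "g (n, bs)") auto
  qed auto
qed

lemma shifted_eqD:
  assumes "shifted f = shifted g"
  shows "f = g"
proof
  fix p :: point
  obtain n bs where p: "p = (n, bs)" by force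
  have "shifted f (Suc n, bs) = shifted g (Suc n, bs)" using assms by simp
  then show "f p = g p" by (simp add: p prod_eq_iff)
qed

lemma shifted_funpow: "shifted (f ^^ n) = shifted f ^^ n"
  by (induction n) (simp_all only: funpow.simps shifted_comp shifted_id)

lemma funpow_shifted_simps:
  "(shifted ^^ 0) f = f" "(shifted ^^ Suc k) f = shifted ((shifted ^^ k) f)"
  by simp_all

lemma funpow_shifted_comp: "(shifted ^^ k) (f \<circ> g) = (shifted ^^ k) f \<circ> (shifted ^^ k) g"
  by (induction k) (simp_all only: funpow_shifted_simps shifted_comp)

lemma funpow_shifted_id: "(shifted ^^ k) id = id"
  by (induction k) (simp_all only: funpow_shifted_simps shifted_id)

text \<open>After two trees are joined, acting on all trees but the first is what acting on all trees
  but the first two was before. This one identity contains all the relations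
  \<open>x\<^sub>j x\<^sub>i = x\<^sub>i x\<^sub>j\<^sub>+\<^sub>1\<close>.\<close>

lemma shifted_merge: "shifted f \<circ> merge = merge \<circ> shifted (shifted f)"
proof
  fix p :: point show "(shifted f \<circ> merge) p = (merge \<circ> shifted (shifted f)) p"
  proof (cases p rule: merge.cases)
    case (3 n bs)
    then show ?thesis by (cases "f (n, bs)") auto
  qed auto
qed

lemma unmerge_shifted: "unmerge \<circ> shifted f = shifted (shifted f) \<circ> unmerge"
proof -
  have "unmerge \<circ> shifted f = unmerge \<circ> (shifted f \<circ> merge) \<circ> unmerge"
    by (simp add: comp_assoc merge_unmerge)
  also have "\<dots> = (unmerge \<circ> merge) \<circ> shifted (shifted f) \<circ> unmerge"
    by (simp only: shifted_merge comp_assoc)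
  finally show ?thesis by (simp add: unmerge_merge)
qed

lemma shifted_merge_funpow: "shifted f \<circ> merge ^^ r = merge ^^ r \<circ> (shifted ^^ Suc r) f"
proof (induction r)
  case (Suc r)
  have "shifted f \<circ> merge ^^ Suc r = shifted f \<circ> merge ^^ r \<circ> merge"
    by (simp only: funpow_Suc_right comp_assoc)
  also have "\<dots> = merge ^^ r \<circ> (shifted ((shifted ^^ r) f) \<circ> merge)"
    by (simp only: Suc comp_assoc funpow_shifted_simps)
  also have "\<dots> = merge ^^ Suc r \<circ> (shifted ^^ Suc (Suc r)) f"
    by (simp only: shifted_merge funpow_Suc_right[of r merge] comp_assoc funpow_shifted_simps)
  finally show ?case .
qed simp

lemma unmerge_merge_funpow: "unmerge ^^ r \<circ> merge ^^ r = id"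
proof (induction r)
  case (Suc r)
  have "unmerge ^^ Suc r \<circ> merge ^^ Suc r = unmerge ^^ r \<circ> (unmerge \<circ> merge) \<circ> merge ^^ r"
    by (simp only: funpow_Suc_right[of r unmerge] funpow.simps(2)[of r merge] comp_assoc)
  then show ?case by (simp only: Suc unmerge_merge o_id)
qed simp

lemma merge_funpow_0: "(merge ^^ r) (0, bs) = (0, replicate r False @- bs)"
  by (induction r) auto

lemma unmerge_funpow_0: "(unmerge ^^ r) (0, replicate r False @- bs) = (0, bs)"
  using fun_cong[OF unmerge_merge_funpow[of r], of "(0, bs)"] by (simp add: merge_funpow_0)

section \<open>Transformations described by exponent lists\<close>

text \<open>The list \<open>[(r\<^sub>0, s\<^sub>0), \<dots>, (r\<^sub>M, s\<^sub>M)]\<close> stands for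
  \<open>x\<^sub>0\<^bsup>r\<^sub>0\<^esup> \<cdots> x\<^sub>M\<^bsup>r\<^sub>M\<^esup> x\<^sub>M\<^bsup>-s\<^sub>M\<^esup> \<cdots> x\<^sub>0\<^bsup>-s\<^sub>0\<^esup>\<close>. Splitting off the outermost powers leaves an element of the
  same form with all indices raised by one.\<close>

fun eval :: "(nat \<times> nat) list \<Rightarrow> point \<Rightarrow> point" where
  "eval [] = id"
| "eval ((r, s) # l) = merge ^^ r \<circ> shifted (eval l) \<circ> unmerge ^^ s"

definition exponent_sum :: "(nat \<times> nat) list \<Rightarrow> nat" where
  "exponent_sum l = (\<Sum>(r, s)\<leftarrow>l. r + s)"

lemma exponent_sum_simps [simp]:
  "exponent_sum [] = 0" "exponent_sum ((r, s) # l) = r + s + exponent_sum l"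
  "exponent_sum (l @ l') = exponent_sum l + exponent_sum l'"
  by (simp_all add: exponent_sum_def)

definition weight :: "(nat \<times> nat) list \<Rightarrow> nat" where
  "weight l = exponent_sum l + length l"

lemma eval_merge_Cons: "merge \<circ> eval ((r, s) # l) = eval ((Suc r, s) # l)"
  by (simp add: comp_assoc)

lemma eval_unmerge_Cons: "unmerge \<circ> eval ((Suc r, s) # l) = eval ((r, s) # l)"
proof -
  have "unmerge \<circ> eval ((Suc r, s) # l) = (unmerge \<circ> merge) \<circ> eval ((r, s) # l)"
    by (simp add: comp_assoc)
  then show ?thesis by (simp add: unmerge_merge)
qed

lemma eval_unmerge_Cons_0: "unmerge \<circ> eval ((0, s) # l) = eval ((0, Suc s) # (0, 0) # l)"
proof -
  have "unmerge \<circ> eval ((0, s) # l) = (unmerge \<circ> shifted (eval l)) \<circ> unmerge ^^ s"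
    by (simp add: comp_assoc)
  then show ?thesis by (simp add: unmerge_shifted comp_assoc)
qed

text \<open>A letter of index \<open>k + 1\<close> commutes past \<open>x\<^sub>0\<^bsup>r\<^esup>\<close> at the price of raising its index by \<open>r\<close>.\<close>

lemma eval_shifted_Cons:
  assumes "eval l' = (shifted ^^ (k + r)) y \<circ> eval l"
  shows "eval ((r, s) # l') = (shifted ^^ Suc k) y \<circ> eval ((r, s) # l)"
proof -
  have "(shifted ^^ Suc k) y \<circ> eval ((r, s) # l)
      = (shifted ((shifted ^^ k) y) \<circ> merge ^^ r) \<circ> shifted (eval l) \<circ> unmerge ^^ s"
    by (simp only: eval.simps comp_assoc funpow_shifted_simps)
  also have "\<dots> = merge ^^ r \<circ> (shifted ^^ Suc r) ((shifted ^^ k) y) \<circ> shifted (eval l) \<circ> unmerge ^^ s"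
    unfolding shifted_merge_funpow ..
  also have "(shifted ^^ Suc r) ((shifted ^^ k) y) = shifted ((shifted ^^ (k + r)) y)"
    by (simp add: funpow_add add.commute[of k])
  also have "merge ^^ r \<circ> shifted ((shifted ^^ (k + r)) y) \<circ> shifted (eval l) \<circ> unmerge ^^ s
      = merge ^^ r \<circ> shifted ((shifted ^^ (k + r)) y \<circ> eval l) \<circ> unmerge ^^ s"
    by (simp only: shifted_comp comp_assoc)
  also have "\<dots> = eval ((r, s) # l')"
    by (simp only: eval.simps assms)
  finally show ?thesis by (rule sym)
qed

text \<open>Multiplying by one letter adds at most one to the exponent sum, but the list may become
  as long as the final index of the letter demands. That index is at most \<open>k\<close> plus the exponent
  sum, so a bound on exponent sum and length together survives repeated multiplication.\<close>

lemma eval_insert: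
  assumes "y \<in> {merge, unmerge}"
  shows "\<exists>l'. eval l' = (shifted ^^ k) y \<circ> eval l \<and> exponent_sum l' \<le> Suc (exponent_sum l) \<and>
    length l' \<le> max (Suc (length l)) (Suc (k + exponent_sum l))"
proof (induction l arbitrary: k)
  case Nil
  have y: "y = eval [(1, 0)] \<or> y = eval [(0, 1)]" using assms by auto
  show ?case
  proof (induction k)
    case 0
    have "y = (shifted ^^ 0) y \<circ> eval []" by simp
    with y show ?case
      by (elim disjE; intro exI conjI) (auto simp del: eval.simps)
  next
    case (Suc k)
    then obtain l where "eval l = (shifted ^^ k) y" "exponent_sum l \<le> 1" "length l \<le> Suc k"
      by auto
    then show ?case by (intro exI[of _ "(0, 0) # l"]) auto
  qed
next
  case (Cons p l)
  obtain r s where p: "p = (r, s)" by force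
  show ?case
  proof (cases k)
    case 0
    consider "y = merge" | r' where "y = unmerge" "r = Suc r'" | "y = unmerge" "r = 0"
      using assms by (cases r) auto
    then show ?thesis
    proof cases
      case 1
      then show ?thesis
        unfolding p 0 using eval_merge_Cons[of r s l]
        by (intro exI[of _ "(Suc r, s) # l"]) (auto simp del: eval.simps)
    next
      case 2
      then show ?thesis
        unfolding p 0 using eval_unmerge_Cons[of r' s l]
        by (intro exI[of _ "(r', s) # l"]) (auto simp del: eval.simps)
    next
      case 3
      then show ?thesis
        unfolding p 0 using eval_unmerge_Cons_0[of s l]
        by (intro exI[of _ "(0, Suc s) # (0, 0) # l"]) (auto simp del: eval.simps)
    qed
  next
    case (Suc k')
    obtain l' where l': "eval l' = (shifted ^^ (k' + r)) y \<circ> eval l"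
      "exponent_sum l' \<le> Suc (exponent_sum l)"
      "length l' \<le> max (Suc (length l)) (Suc (k' + r + exponent_sum l))"
      using Cons.IH by blast
    show ?thesis
      unfolding p Suc
    proof (intro exI conjI)
      show "eval ((r, s) # l') = (shifted ^^ Suc k') y \<circ> eval ((r, s) # l)"
        by (rule eval_shifted_Cons[OF l'(1)])
    qed (use l'(2,3) in auto)
  qed
qed

section \<open>Reduced exponent lists\<close>

fun reduced :: "(nat \<times> nat) list \<Rightarrow> bool" where
  "reduced [] \<longleftrightarrow> True"
| "reduced [(r, s)] \<longleftrightarrow> (r \<noteq> 0) \<noteq> (s \<noteq> 0)"
| "reduced ((r, s) # (r', s') # l) \<longleftrightarrow> (r * s > 0 \<longrightarrow> r' + s' > 0) \<and> reduced ((r', s') # l)"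

lemma reduced_tl: "reduced (p # l) \<Longrightarrow> reduced l"
  by (cases p; cases l) auto

text \<open>The rewriting step is \<open>x\<^sub>0 w x\<^sub>0\<^sup>-\<^sup>1 = w'\<close> for \<open>w\<close> in the \<open>x\<^sub>2, x\<^sub>3, \<dots>\<close>, where \<open>w'\<close> is \<open>w\<close> with
  all indices lowered by one.\<close>

lemma eval_conjugate: "eval ((Suc r, Suc s) # (0, 0) # l) = eval ((r, s) # l)"
proof -
  have "merge \<circ> shifted (shifted (eval l)) \<circ> unmerge = shifted (eval l) \<circ> (merge \<circ> unmerge)"
    by (simp add: shifted_merge flip: comp_assoc)
  then have *: "merge \<circ> shifted (shifted (eval l)) \<circ> unmerge = shifted (eval l)"
    by (simp add: merge_unmerge)
  have "eval ((Suc r, Suc s) # (0, 0) # l)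
      = merge ^^ r \<circ> (merge \<circ> shifted (shifted (eval l)) \<circ> unmerge) \<circ> unmerge ^^ s"
    by (simp add: comp_assoc funpow_Suc_right[of r] del: funpow.simps(2))
      (simp add: comp_assoc)
  then show ?thesis unfolding * by simp
qed

lemma eval_cancel: "eval [(Suc r, Suc s)] = eval [(r, s)]"
  using eval_conjugate[of r s "[]"] by simp

lemma eval_lighter:
  "\<not> reduced l \<Longrightarrow> \<exists>l'. eval l' = eval l \<and> weight l' < weight l"
proof (induction l rule: reduced.induct)
  case (2 r s)
  consider "r = 0" "s = 0" | r' s' where "r = Suc r'" "s = Suc s'"
    using 2 by (cases r; cases s) auto
  then show ?case
  proof cases
    case 1
    then show ?thesis by (intro exI[of _ "[]"]) (simp add: weight_def)
  next
    case 2
    then show ?thesis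
      by (intro exI[of _ "[(r', s')]"]) (simp add: weight_def eval_cancel del: eval.simps)
  qed
next
  case (3 r s r' s' l)
  show ?case
  proof (cases "reduced ((r', s') # l)")
    case True
    then have "r > 0" "s > 0" "r' = 0" "s' = 0" using "3.prems" by auto
    moreover from this obtain r0 s0 where "r = Suc r0" "s = Suc s0"
      by (metis gr0_implies_Suc)
    ultimately show ?thesis
      by (intro exI[of _ "(r0, s0) # l"]) (simp add: weight_def eval_conjugate del: eval.simps)
  next
    case False
    then obtain l' where "eval l' = eval ((r', s') # l)" "weight l' < weight ((r', s') # l)"
      using "3.IH" by blast
    then show ?thesis by (intro exI[of _ "(r, s) # l'"]) (simp add: weight_def)
  qed
qed simp

lemma ex_reduced: "\<exists>l'. eval l' = eval l \<and> weight l' \<le> weight l \<and> reduced l'"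
proof (induction "weight l" arbitrary: l rule: less_induct)
  case less
  show ?case
  proof (cases "reduced l")
    case False
    then obtain l' where "eval l' = eval l" "weight l' < weight l" using eval_lighter by blast
    then show ?thesis using less[of l'] by (metis less_imp_le order_trans)
  qed blast
qed

section \<open>Uniqueness of reduced lists\<close>

text \<open>All \<open>x\<^sub>i\<close> with \<open>i > 0\<close> fix tree \<open>0\<close>, so on the leftmost end of that tree only the two powers of
  \<open>x\<^sub>0\<close> are visible. In terms of piecewise linear maps this computes the slope at the left
  endpoint as \<open>2\<close> to the power \<open>s - r\<close>.\<close>

lemma eval_leftmost:
  "eval ((r, s) # l) (0, replicate s False @- bs) = (0, replicate r False @- bs)"
  by (simp add: unmerge_funpow_0 merge_funpow_0)

lemma replicate_False_inject:
  "replicate m False @- sconst True = replicate n False @- sconst True \<Longrightarrow> m = n"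
proof (induction m arbitrary: n)
  case 0
  then show ?case by (cases n) (auto dest: arg_cong[of _ _ shd])
next
  case (Suc m)
  then show ?case by (cases n) (auto dest: arg_cong[of _ _ shd])
qed

lemma replicate_add_shift: "replicate (m + n) b @- bs = replicate m b @- replicate n b @- bs"
  by (simp add: replicate_add)

lemma eval_slope:
  assumes "\<And>bs. eval ((r, s) # l) (0, bs) = eval ((r', s') # l') (0, bs)"
  shows "r + s' = r' + s"
proof -
  let ?t = "sconst True"
  have "eval ((r, s) # l) (0, replicate (s + s') False @- ?t) = (0, replicate (r + s') False @- ?t)"
    unfolding replicate_add_shift by (rule eval_leftmost)
  moreover have "eval ((r', s') # l') (0, replicate (s' + s) False @- ?t) = (0, replicate (r' + s) False @- ?t)"
    unfolding replicate_add_shift by (rule eval_leftmost)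
  ultimately show ?thesis
    using assms[of "replicate (s + s') False @- ?t"] replicate_False_inject[of "r + s'" "r' + s"]
    by (simp add: add.commute del: eval.simps)
qed

definition fixes_tree0 :: "(point \<Rightarrow> point) \<Rightarrow> bool" where
  "fixes_tree0 f \<longleftrightarrow> (\<forall>bs. f (0, bs) = (0, bs))"

text \<open>Joining puts tree \<open>1\<close> inside tree \<open>0\<close>; a conjugate by a positive power of \<open>x\<^sub>0\<close> that is trivial
  on tree \<open>0\<close> must therefore come from something trivial on tree \<open>1\<close> as well.\<close>

lemma fixes_tree0_conjugate:
  assumes "fixes_tree0 (merge ^^ Suc d \<circ> shifted f \<circ> unmerge ^^ Suc d)"
  shows "fixes_tree0 f"
  unfolding fixes_tree0_def
proof
  fix bs
  let ?p = "(Suc 0, bs) :: point"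
  let ?m = "merge ^^ Suc d" and ?u = "unmerge ^^ Suc d"
  have um: "?u (?m q) = q" for q
    using fun_cong[OF unmerge_merge_funpow[of "Suc d"], of q] by simp
  have "?m ?p = (0, replicate d False @- (True ## bs))"
    by (simp only: funpow_Suc_right comp_apply merge.simps merge_funpow_0)
  then have "?m (shifted f (?u (?m ?p))) = ?m ?p"
    using assms unfolding fixes_tree0_def by (simp only: comp_apply)
  then have "shifted f ?p = ?p" by (metis um)
  then show "f (0, bs) = (0, bs)" by (simp add: prod_eq_iff)
qed

text \<open>If both \<open>x\<^sub>0\<close> and \<open>x\<^sub>0\<^sup>-\<^sup>1\<close> occur, reducedness makes \<open>x\<^sub>1\<close> or its inverse occur, and the previous
  lemma passes the same situation on to the rest of the list. The last pair, where exactly one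
  exponent is nonzero, ends the descent by its slope.\<close>

lemma reduced_moves_tree0:
  assumes "reduced ((r, s) # l)" "r + s > 0"
  shows "\<not> fixes_tree0 (eval ((r, s) # l))"
  using assms
proof (induction l arbitrary: r s)
  case Nil
  show ?case
  proof
    assume "fixes_tree0 (eval [(r, s)])"
    then have "eval [(r, s)] (0, bs) = eval [(0, 0)] (0, bs)" for bs
      by (simp add: fixes_tree0_def)
    from eval_slope[OF this] show False using Nil by simp
  qed
next
  case (Cons p l)
  obtain r' s' where p: "p = (r', s')" by force
  show ?case
  proof
    assume fixed: "fixes_tree0 (eval ((r, s) # p # l))"
    then have "eval ((r, s) # p # l) (0, bs) = eval [(0, 0)] (0, bs)" for bs
      by (simp add: fixes_tree0_def)
    from eval_slope[OF this] have "r = s" by simp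
    then obtain d where d: "r = Suc d" "s = Suc d" using Cons.prems by (cases r) auto
    have "fixes_tree0 (merge ^^ Suc d \<circ> shifted (eval (p # l)) \<circ> unmerge ^^ Suc d)"
      using fixed unfolding d p by (simp only: eval.simps)
    then have "fixes_tree0 (eval (p # l))" by (rule fixes_tree0_conjugate)
    then show False using Cons unfolding p d by (auto simp del: eval.simps)
  qed
qed

text \<open>Otherwise cancelling the common powers of \<open>x\<^sub>0\<close> would write an element of the subgroup of
  \<open>x\<^sub>1, x\<^sub>2, \<dots>\<close>, which fixes tree \<open>0\<close>, as a conjugate by \<open>x\<^sub>0\<^bsup>d + 1\<^esup>\<close>. Reducedness forces a power
  of \<open>x\<^sub>1\<close> in the conjugated element, and \<open>reduced_moves_tree0\<close> applies to it.\<close>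

lemma reduced_common_power_neq:
  assumes "reduced ((r + Suc d, s + Suc d) # l)"
  shows "eval ((r + Suc d, s + Suc d) # l) \<noteq> eval ((r, s) # l')"
proof
  assume eq: "eval ((r + Suc d, s + Suc d) # l) = eval ((r, s) # l')"
  let ?f = "merge ^^ Suc d \<circ> shifted (eval l) \<circ> unmerge ^^ Suc d"
  have split: "eval ((r + Suc d, s + Suc d) # l) = merge ^^ r \<circ> ?f \<circ> unmerge ^^ s"
    by (simp only: eval.simps funpow_add[of r] add.commute[of s] funpow_add[of "Suc d"] comp_assoc)
  have "?f = (unmerge ^^ r \<circ> merge ^^ r) \<circ> ?f \<circ> (unmerge ^^ s \<circ> merge ^^ s)"
    by (simp only: unmerge_merge_funpow id_o o_id)
  also have "\<dots> = unmerge ^^ r \<circ> eval ((r, s) # l') \<circ> merge ^^ s"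
    unfolding eq[symmetric] split by (simp only: comp_assoc)
  also have "\<dots> = (unmerge ^^ r \<circ> merge ^^ r) \<circ> shifted (eval l') \<circ> (unmerge ^^ s \<circ> merge ^^ s)"
    by (simp only: eval.simps comp_assoc)
  also have "\<dots> = shifted (eval l')"
    by (simp only: unmerge_merge_funpow id_o o_id)
  finally have "?f = shifted (eval l')" .
  then have "fixes_tree0 ?f" by (simp only:) (simp add: fixes_tree0_def)
  then have "fixes_tree0 (eval l)" by (rule fixes_tree0_conjugate)
  then show False
  proof (cases l)
    case Nil
    then show ?thesis using assms by simp
  next
    case (Cons p k)
    obtain r' s' where "p = (r', s')" by force
    then show ?thesis
      using assms reduced_moves_tree0[of r' s' k] \<open>fixes_tree0 (eval l)\<close> Cons
      by (auto simp del: eval.simps)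
  qed
qed

text \<open>The slope fixes the difference \<open>r - s\<close>, so distinct leading pairs differ by a common positive
  amount. The pair \<open>(0, 0)\<close> is admitted on the right without reducedness to cover the identity,
  as \<open>eval [(0, 0)]\<close>.\<close>

lemma reduced_hd_unique:
  assumes "reduced ((r, s) # l)" "reduced ((r', s') # l') \<or> r' = 0 \<and> s' = 0"
    and eq: "eval ((r, s) # l) = eval ((r', s') # l')"
  shows "r = r' \<and> s = s' \<and> eval l = eval l'"
proof -
  have slope: "r + s' = r' + s" using eq by (intro eval_slope[of r s l r' s' l']) simp
  have "r = r'"
  proof (rule ccontr)
    assume "r \<noteq> r'"
    then consider d where "r = r' + Suc d" | d where "r' = r + Suc d"
      by (metis add.commute less_imp_Suc_add linorder_neqE_nat add_Suc_right)
    then show False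
    proof cases
      case 1
      then have "s = s' + Suc d" using slope by simp
      then show ?thesis using reduced_common_power_neq assms(1) eq 1 by metis
    next
      case 2
      then have "s' = s + Suc d" using slope by simp
      then show ?thesis using reduced_common_power_neq[of r d s l' l] assms(2) eq 2 by auto
    qed
  qed
  moreover from this have "s = s'" using slope by simp
  moreover have "shifted (eval k) = unmerge ^^ r \<circ> eval ((r, s) # k) \<circ> merge ^^ s" for k
  proof -
    have "unmerge ^^ r \<circ> eval ((r, s) # k) \<circ> merge ^^ s
        = (unmerge ^^ r \<circ> merge ^^ r) \<circ> shifted (eval k) \<circ> (unmerge ^^ s \<circ> merge ^^ s)"
      by (simp only: eval.simps comp_assoc)
    then show ?thesis by (simp only: unmerge_merge_funpow id_o o_id)
  qed
  ultimately show ?thesis using eq by (metis shifted_eqD)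
qed

lemma reduced_eval_id:
  assumes "reduced l" "eval l = id"
  shows "l = []"
  using assms
proof (induction l)
  case (Cons p l)
  obtain r s where p: "p = (r, s)" by force
  have "r = 0 \<and> s = 0 \<and> eval l = eval []"
    using Cons.prems by (intro reduced_hd_unique) (simp_all only: p eval.simps funpow.simps shifted_id o_id simp_thms)
  then have "l = []" using Cons reduced_tl by auto
  then show ?case using Cons.prems \<open>r = 0 \<and> s = 0 \<and> eval l = eval []\<close> by (simp add: p)
qed simp

lemma reduced_unique:
  assumes "reduced l" "reduced l'" "eval l = eval l'"
  shows "l = l'"
  using assms
proof (induction l arbitrary: l')
  case Nil
  then show ?case using reduced_eval_id[of l'] by (metis eval.simps(1))
next
  case (Cons p l)
  show ?case
  proof (cases l')
    case Nil
    then show ?thesis using Cons.prems reduced_eval_id[of "p # l"] by (metis eval.simps(1))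
  next
    case (Cons p' k)
    obtain r s r' s' where p: "p = (r, s)" "p' = (r', s')" by force
    have "r = r' \<and> s = s' \<and> eval l = eval k"
      using Cons.prems unfolding Cons p by (intro reduced_hd_unique disjI1)
    then show ?thesis
      using Cons.IH[of k] Cons.prems reduced_tl unfolding Cons p by auto
  qed
qed

section \<open>The action of Thompson's group\<close>

fun letter_action :: "nat \<times> bool \<Rightarrow> point \<Rightarrow> point" where
  "letter_action (i, b) = (shifted ^^ i) (if b then merge else unmerge)"

definition word_action :: "nat gword \<Rightarrow> point \<Rightarrow> point" where
  "word_action w = foldr (\<lambda>a f. letter_action a \<circ> f) w id"

lemma word_action_simps [simp]:
  "word_action [] = id" "word_action (a # w) = letter_action a \<circ> word_action w"
  by (simp_all add: word_action_def)

lemma word_action_append: "word_action (u @ v) = word_action u \<circ> word_action v"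
  by (induction u) (simp_all add: comp_assoc)

lemma letter_action_rel:
  assumes "i < j"
  shows "(shifted ^^ j) merge \<circ> (shifted ^^ i) merge = (shifted ^^ i) merge \<circ> (shifted ^^ Suc j) merge"
proof -
  obtain k where j: "j = i + Suc k" using assms less_imp_Suc_add by auto
  have "(shifted ^^ i) (shifted ((shifted ^^ k) merge) \<circ> merge)
      = (shifted ^^ i) (merge \<circ> shifted (shifted ((shifted ^^ k) merge)))"
    by (simp only: shifted_merge)
  then show ?thesis
    unfolding funpow_shifted_comp j by (simp add: funpow_add funpow_swap1)
qed

lemma word_action_pres_eq:
  "pres_eq thompson_rels u v \<Longrightarrow> word_action u = word_action v"
proof (induction rule: pres_eq.induct)
  case (pres_rel u v)
  then show ?case by (auto simp: thompson_rels_def letter_action_rel simp del: funpow.simps)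
next
  case (pres_cancel g b)
  have "(shifted ^^ g) (y \<circ> z) = id" if "y \<circ> z = id" for y z
    by (simp add: that funpow_shifted_id)
  then show ?case
    by (cases b) (simp_all only: word_action_simps letter_action.simps o_id unmerge_merge
      merge_unmerge funpow_shifted_id simp_thms if_True if_False flip: funpow_shifted_comp)
qed (auto simp: word_action_append)

definition action :: "nat gword set \<Rightarrow> point \<Rightarrow> point" where
  "action g = word_action (SOME w. w \<in> g)"

lemma action_pres_class: "action (pres_class thompson_rels w) = word_action w"
proof -
  have "w \<in> pres_class thompson_rels w" by (simp add: pres_class_def pres_refl)
  then have "(SOME v. v \<in> pres_class thompson_rels w) \<in> pres_class thompson_rels w" by (rule someI)
  then show ?thesis by (simp add: action_def pres_class_def word_action_pres_eq)
qed

lemma action_one: "action \<one>\<^bsub>ThompsonF\<^esub> = id"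
  by (simp add: ThompsonF_def presented_one action_pres_class)

lemma action_mult:
  assumes "g \<in> carrier ThompsonF" "h \<in> carrier ThompsonF"
  shows "action (g \<otimes>\<^bsub>ThompsonF\<^esub> h) = action g \<circ> action h"
  using assms
  by (auto simp: ThompsonF_def presented_carrier presented_mult action_pres_class word_action_append)

lemma action_xgen: "action (xgen i) = (shifted ^^ i) merge"
  by (simp add: xgen_def action_pres_class)

lemma action_inv_xgen: "action (inv\<^bsub>ThompsonF\<^esub> xgen i) = (shifted ^^ i) unmerge"
proof -
  let ?f = "action (inv\<^bsub>ThompsonF\<^esub> xgen i)"
  have "?f \<circ> (shifted ^^ i) merge = id"
    using action_mult[of "inv\<^bsub>ThompsonF\<^esub> xgen i" "xgen i"] by (simp add: action_one action_xgen)
  moreover have "(shifted ^^ i) merge \<circ> (shifted ^^ i) unmerge = id"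
    by (simp add: merge_unmerge funpow_shifted_id flip: funpow_shifted_comp)
  ultimately show ?thesis by (metis comp_assoc comp_id id_comp)
qed

lemma action_nat_pow:
  assumes "g \<in> carrier ThompsonF"
  shows "action (g [^]\<^bsub>ThompsonF\<^esub> (n::nat)) = action g ^^ n"
proof (induction n)
  case (Suc n)
  then show ?case
    using assms by (simp add: action_mult funpow_Suc_right del: funpow.simps)
qed (simp add: action_one)

lemma action_xgen_pow:
  "action (xgen i [^]\<^bsub>ThompsonF\<^esub> int n) = (shifted ^^ i) merge ^^ n"
  "action (xgen i [^]\<^bsub>ThompsonF\<^esub> (- int n)) = (shifted ^^ i) unmerge ^^ n"
proof -
  show "action (xgen i [^]\<^bsub>ThompsonF\<^esub> int n) = (shifted ^^ i) merge ^^ n"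
    by (simp add: int_pow_int action_nat_pow action_xgen)
  have "xgen i [^]\<^bsub>ThompsonF\<^esub> (- int n) = (inv\<^bsub>ThompsonF\<^esub> xgen i) [^]\<^bsub>ThompsonF\<^esub> n"
    by (simp add: F.int_pow_neg int_pow_int F.nat_pow_inv)
  then show "action (xgen i [^]\<^bsub>ThompsonF\<^esub> (- int n)) = (shifted ^^ i) unmerge ^^ n"
    by (simp add: action_nat_pow action_inv_xgen)
qed

text \<open>For a word of length \<open>n\<close>, each letter has index at most \<open>1\<close> and the exponent sum stays at
  most \<open>n\<close>, so the bounds in \<open>eval_insert\<close> add up to a linear bound on the length.\<close>

lemma word_value_eval:
  assumes "w \<in> lists Xgens"
  shows "\<exists>l. eval l = action (word_value ThompsonF w) \<and>
    exponent_sum l \<le> length w \<and> length l \<le> Suc (length w)"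
  using assms
proof (induction w)
  case Nil
  then show ?case by (intro exI[of _ "[]"]) (simp add: word_value_def action_one)
next
  case (Cons g w)
  then obtain l where l: "eval l = action (word_value ThompsonF w)"
    "exponent_sum l \<le> length w" "length l \<le> Suc (length w)"
    by auto
  obtain k y where g: "action g = (shifted ^^ k) y" "y \<in> {merge, unmerge}" "k \<le> 1"
  proof -
    have "\<exists>k y. action g = (shifted ^^ k) y \<and> y \<in> {merge, unmerge} \<and> k \<le> 1"
      using Cons.hyps Cons.prems action_xgen action_inv_xgen unfolding Xgens_def
      by (auto simp del: funpow.simps; blast)
    then show ?thesis using that by blast
  qed
  obtain l' where l': "eval l' = (shifted ^^ k) y \<circ> eval l" "exponent_sum l' \<le> Suc (exponent_sum l)"
    "length l' \<le> max (Suc (length l)) (Suc (k + exponent_sum l))"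
    using eval_insert[OF g(2)] by blast
  have carrier: "g \<in> carrier ThompsonF" "word_value ThompsonF w \<in> carrier ThompsonF"
    using Cons.prems Cons.hyps Xgens_carrier word_value_append(1)[of w "[]"] by auto
  have "action (word_value ThompsonF (g # w)) = action g \<circ> action (word_value ThompsonF w)"
    using action_mult[OF carrier] by (simp add: word_value_def)
  then show ?case using l' l g by (intro exI[of _ l']) auto
qed

section \<open>From strings to exponent lists\<close>

definition exponents :: "(nat \<Rightarrow> nat) \<Rightarrow> (nat \<Rightarrow> nat) \<Rightarrow> nat \<Rightarrow> (nat \<times> nat) list" where
  "exponents r s M = map (\<lambda>i. (r i, s i)) [0..<Suc M]"

lemma exponents_0: "exponents r s 0 = [(r 0, s 0)]"
  by (simp add: exponents_def)

lemma exponents_Suc: "exponents r s (Suc M) = exponents r s M @ [(r (Suc M), s (Suc M))]"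
  by (simp add: exponents_def)

lemma exponents_Suc_Cons: "exponents r s (Suc M) = (r 0, s 0) # exponents (r \<circ> Suc) (s \<circ> Suc) M"
  by (induction M) (simp_all add: exponents_0 exponents_Suc)

lemma weight_exponents: "weight (exponents r s M) = Suc (length (nf_string r s M))"
  by (induction M) (simp_all add: exponents_0 exponents_Suc weight_def block_def)

lemma reduced_exponents:
  assumes "(r M \<noteq> 0) \<noteq> (s M \<noteq> 0)" "\<forall>i<M. r i * s i > 0 \<longrightarrow> r (Suc i) + s (Suc i) > 0"
  shows "reduced (exponents r s M)"
  using assms
proof (induction M arbitrary: r s)
  case (Suc M)
  have "reduced (exponents (r \<circ> Suc) (s \<circ> Suc) M)"
    by (rule Suc.IH) (use Suc.prems in auto)
  moreover obtain l where "exponents (r \<circ> Suc) (s \<circ> Suc) M = (r (Suc 0), s (Suc 0)) # l"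
    by (cases M) (simp_all add: exponents_0 exponents_Suc_Cons)
  ultimately show ?case using Suc.prems(2) by (auto simp: exponents_Suc_Cons)
qed (simp add: exponents_0)

lemma pos_part_closed: "pos_part r M \<in> carrier ThompsonF"
  by (induction M) simp_all

lemma neg_part_closed: "neg_part s M \<in> carrier ThompsonF"
  by (induction M) simp_all

text \<open>\<^const>\<open>pos_part\<close> and \<^const>\<open>neg_part\<close> grow at their inner ends, \<^const>\<open>eval\<close> at its outer ends.\<close>

lemma action_pos_part_Suc:
  "action (pos_part r (Suc M)) = merge ^^ r 0 \<circ> shifted (action (pos_part (r \<circ> Suc) M))"
proof (induction M)
  case 0
  then show ?case by (simp add: action_mult action_xgen_pow action_xgen_pow(1)[where i = 0, simplified] shifted_funpow)
next
  case (Suc M)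
  have "action (pos_part r (Suc (Suc M)))
      = action (pos_part r (Suc M)) \<circ> (shifted ^^ Suc (Suc M)) merge ^^ r (Suc (Suc M))"
    using pos_part_closed[of r "Suc M"]
    by (subst pos_part.simps) (simp add: action_mult action_xgen_pow del: pos_part.simps funpow.simps)
  also have "\<dots> = merge ^^ r 0 \<circ> shifted (action (pos_part (r \<circ> Suc) M)
      \<circ> (shifted ^^ Suc M) merge ^^ (r \<circ> Suc) (Suc M))"
    by (simp only: Suc shifted_comp shifted_funpow comp_assoc comp_apply[of r Suc "Suc M"] funpow_shifted_simps)
  also have "\<dots> = merge ^^ r 0 \<circ> shifted (action (pos_part (r \<circ> Suc) (Suc M)))"
    using pos_part_closed[of "r \<circ> Suc" M]
    by (simp add: action_mult action_xgen_pow del: funpow.simps)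
  finally show ?case .
qed

lemma action_neg_part_Suc:
  "action (neg_part s (Suc M)) = shifted (action (neg_part (s \<circ> Suc) M)) \<circ> unmerge ^^ s 0"
proof (induction M)
  case 0
  then show ?case by (simp add: action_mult action_xgen_pow action_xgen_pow(2)[where i = 0, simplified] shifted_funpow)
next
  case (Suc M)
  have "action (neg_part s (Suc (Suc M)))
      = (shifted ^^ Suc (Suc M)) unmerge ^^ s (Suc (Suc M)) \<circ> action (neg_part s (Suc M))"
    using neg_part_closed[of s "Suc M"]
    by (subst neg_part.simps) (simp add: action_mult action_xgen_pow del: neg_part.simps funpow.simps)
  also have "\<dots> = shifted ((shifted ^^ Suc M) unmerge ^^ (s \<circ> Suc) (Suc M)
      \<circ> action (neg_part (s \<circ> Suc) M)) \<circ> unmerge ^^ s 0"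
    by (simp only: Suc shifted_comp shifted_funpow comp_assoc comp_apply[of s Suc "Suc M"] funpow_shifted_simps)
  also have "\<dots> = shifted (action (neg_part (s \<circ> Suc) (Suc M))) \<circ> unmerge ^^ s 0"
    using neg_part_closed[of "s \<circ> Suc" M]
    by (simp add: action_mult action_xgen_pow del: funpow.simps)
  finally show ?case .
qed

lemma action_nf_element: "action (nf_element r s M) = eval (exponents r s M)"
proof -
  have "action (pos_part r M) \<circ> action (neg_part s M) = eval (exponents r s M)"
  proof (induction M arbitrary: r s)
    case 0
    then show ?case
      by (simp add: exponents_0 action_xgen_pow(1)[where i = 0, simplified]
        action_xgen_pow(2)[where i = 0, simplified])
  next
    case (Suc M)
    have "action (pos_part r (Suc M)) \<circ> action (neg_part s (Suc M))
        = merge ^^ r 0 \<circ> shifted (action (pos_part (r \<circ> Suc) M) \<circ> action (neg_part (s \<circ> Suc) M))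
          \<circ> unmerge ^^ s 0"
      unfolding action_pos_part_Suc action_neg_part_Suc by (simp only: shifted_comp comp_assoc)
    then show ?case unfolding Suc exponents_Suc_Cons by simp
  qed
  then show ?thesis by (simp add: nf_element_def action_mult pos_part_closed neg_part_closed)
qed

section \<open>The quasigeodesic bound\<close>

lemma length_nf_string_le:
  assumes "(r M \<noteq> 0) \<noteq> (s M \<noteq> 0)" "\<forall>i<M. r i * s i > 0 \<longrightarrow> r (Suc i) + s (Suc i) > 0"
  shows "length (nf_string r s M) \<le> 2 * geod_length ThompsonF Xgens (nf_element r s M)"
proof -
  let ?g = "nf_element r s M"
  have "?g \<in> carrier ThompsonF" by (simp add: nf_element_def pos_part_closed neg_part_closed)
  then obtain w where w: "w \<in> lists Xgens" "word_value ThompsonF w = ?g"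
    "length w = geod_length ThompsonF Xgens ?g"
    using geod_length_attained by blast
  obtain l where l: "eval l = action ?g" "exponent_sum l \<le> length w" "length l \<le> Suc (length w)"
    using word_value_eval[OF w(1)] w(2) by auto
  obtain l' where l': "eval l' = eval l" "weight l' \<le> weight l" "reduced l'"
    using ex_reduced by blast
  have "l' = exponents r s M"
    using l'(1,3) l(1) by (intro reduced_unique reduced_exponents assms) (simp_all add: action_nf_element)
  then show ?thesis
    using l'(2) l(2,3) weight_exponents[of r s M] w(3) by (simp add: weight_def)
qed

theorem proposition3p3: "quasigeodesic ThompsonF Xgens nf_rep L_inf"
  unfolding quasigeodesic_def
proof (intro exI ballI)
  fix u assume "u \<in> L_inf"
  then have "length u \<le> 2 * geod_length ThompsonF Xgens (nf_rep u)"
  proof (cases "u = []")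
    case False
    then obtain r s M where u: "u = nf_string r s M" and rs: "(r M \<noteq> 0) \<noteq> (s M \<noteq> 0)"
      "\<forall>i<M. r i * s i > 0 \<longrightarrow> r (Suc i) + s (Suc i) > 0"
      using \<open>u \<in> L_inf\<close> unfolding L_inf_def by blast
    then show ?thesis unfolding u nf_rep_nf_string by (intro length_nf_string_le rs)
  qed simp
  then show "real (length u) \<le> 2 * (real (geod_length ThompsonF Xgens (nf_rep u)) + 1)"
    by simp
qed

end
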